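(* Let $D$ be a finite digraph. Then the Ferrers dimension of $D$ equals the total covering number of $J(\overline{D})$.
   Context: Digraphs may have loops and are identified with their $(0,1)$ adjacency matrices; $\overline{D}$ is the digraph on the same vertex set whose adjacency matrix is obtained from that of $D$ by interchanging $0$'s and $1$'s (including diagonal entries). A Ferrers digraph is a digraph whose successor sets $\{u: vu\text{ is an arc}\}$ are linearly ordered by inclusion (equivalently, its adjacency matrix contains no $2\times2$ permutation submatrix). The Ferrers dimension $d_F(D)$ is the minimum number of Ferrers digraphs on $V(D)$ whose intersection (of arc sets) is $D$ (the empty intersection being the complete digraph with all loops). For a digraph $D'=(V,E)$, $J(D')$ is the digraph with vertex set $E$ and an arc from $ab\in E$ to $cd\in E$ iff $ab\neq cd$ and $ad\in E$ (the vertices $a,b,c,d$ need not be distinct). A subdigraph $S$ of $J(D')$ is ideal if whenever $ab\to cd$ is an arc of $S$, then $ad\in V(S)$. An ideal subdigraph $S$ is total if for any distinct $ab,cd\in V(S)$, at least one of $ab\to cd$, $cd\to ab$ is an arc of $S$. The total covering number of $J(D')$ is the minimum number of total subdigraphs of $J(D')$ whose vertex sets together cover $E$. *)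

theory Defs
  imports "Graph_Theory.Graph_Theory"
begin

text \<open>
  Digraphs are of type \<open>'a pair_pre_digraph\<close>: a vertex set \<open>pverts\<close> and an arc set \<open>parcs\<close> of
  ordered pairs. Loops are allowed and parallel arcs cannot occur. Since a record need not be
  well formed, \<^const>\<open>pair_wf_digraph\<close> (arcs join vertices) is demanded where necessary.
\<close>

definition digraph_compl :: "'a pair_pre_digraph \<Rightarrow> 'a pair_pre_digraph" where
  "digraph_compl D = \<lparr> pverts = pverts D, parcs = pverts D \<times> pverts D - parcs D \<rparr>"

definition successors :: "'a pair_pre_digraph \<Rightarrow> 'a \<Rightarrow> 'a set" where
  "successors D v = {u. (v, u) \<in> parcs D}"

definition ferrers_digraph :: "'a pair_pre_digraph \<Rightarrow> bool" where
  "ferrers_digraph D \<longleftrightarrow> pair_wf_digraph D \<and>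
     (\<forall>v \<in> pverts D. \<forall>w \<in> pverts D.
        successors D v \<subseteq> successors D w \<or> successors D w \<subseteq> successors D v)"

text \<open>
  The intersection is taken inside \<open>pverts D \<times> pverts D\<close>, so that the empty family yields the
  complete digraph with all loops.
\<close>

definition ferrers_realizer :: "'a pair_pre_digraph \<Rightarrow> 'a pair_pre_digraph set \<Rightarrow> bool" where
  "ferrers_realizer D \<F> \<longleftrightarrow>
     finite \<F> \<and> (\<forall>F \<in> \<F>. ferrers_digraph F \<and> pverts F = pverts D) \<and>
     parcs D = (pverts D \<times> pverts D) \<inter> (\<Inter>F \<in> \<F>. parcs F)"

definition ferrers_dim :: "'a pair_pre_digraph \<Rightarrow> nat" where
  "ferrers_dim D = (LEAST k. \<exists>\<F>. ferrers_realizer D \<F> \<and> card \<F> = k)"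

definition J_digraph :: "'a pair_pre_digraph \<Rightarrow> ('a \<times> 'a) pair_pre_digraph" where
  "J_digraph D = \<lparr> pverts = parcs D,
     parcs = {((a, b), (c, d)) | a b c d.
       (a, b) \<in> parcs D \<and> (c, d) \<in> parcs D \<and> (a, b) \<noteq> (c, d) \<and> (a, d) \<in> parcs D} \<rparr>"

text \<open>
  Subdigraphs are arbitrary, not necessarily induced: \<open>S\<close> may omit arcs of \<open>J_digraph D\<close> between
  two of its own vertices. An arc of \<open>J_digraph D\<close> that \<open>S\<close> omits imposes no ideal condition.
\<close>

definition ideal_subdigraph ::
    "('a \<times> 'a) pair_pre_digraph \<Rightarrow> 'a pair_pre_digraph \<Rightarrow> bool" where
  "ideal_subdigraph S D \<longleftrightarrow> subgraph (with_proj S) (with_proj (J_digraph D)) \<and>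
     (\<forall>a b c d. ((a, b), (c, d)) \<in> parcs S \<longrightarrow> (a, d) \<in> pverts S)"

definition total_subdigraph ::
    "('a \<times> 'a) pair_pre_digraph \<Rightarrow> 'a pair_pre_digraph \<Rightarrow> bool" where
  "total_subdigraph S D \<longleftrightarrow> ideal_subdigraph S D \<and>
     (\<forall>x \<in> pverts S. \<forall>y \<in> pverts S. x \<noteq> y \<longrightarrow> (x, y) \<in> parcs S \<or> (y, x) \<in> parcs S)"

definition total_cover ::
    "'a pair_pre_digraph \<Rightarrow> ('a \<times> 'a) pair_pre_digraph set \<Rightarrow> bool" where
  "total_cover D \<S> \<longleftrightarrow>
     finite \<S> \<and> (\<forall>S \<in> \<S>. total_subdigraph S D) \<and> parcs D \<subseteq> (\<Union>S \<in> \<S>. pverts S)"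

text \<open>The total covering number of \<open>J_digraph D\<close>, as a function of \<open>D\<close>.\<close>

definition total_covering_number_J :: "'a pair_pre_digraph \<Rightarrow> nat" where
  "total_covering_number_J D = (LEAST k. \<exists>\<S>. total_cover D \<S> \<and> card \<S> = k)"

text \<open>For a finite digraph both minima are attained, so \<^const>\<open>Least\<close> is meaningful above.\<close>

lemma ferrers_dim_attained:
  assumes "pair_fin_digraph D"
  shows "\<exists>\<F>. ferrers_realizer D \<F> \<and> card \<F> = ferrers_dim D"
proof -
  interpret pair_fin_digraph D by fact
  let ?V = "pverts D"
  let ?F = "\<lambda>e. \<lparr> pverts = ?V, parcs = ?V \<times> ?V - {e} \<rparr>"
  let ?\<F> = "?F ` (?V \<times> ?V - parcs D)"
  have fer: "ferrers_digraph (?F e)" for e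
  proof -
    have "pair_wf_digraph (?F e)"
      by unfold_locales auto
    then show ?thesis
      by (cases e) (auto simp: ferrers_digraph_def successors_def)
  qed
  have "parcs D \<subseteq> ?V \<times> ?V"
    using in_arcsD1 in_arcsD2 by auto
  then have "parcs D = (?V \<times> ?V) \<inter> (\<Inter>F \<in> ?\<F>. parcs F)"
    by auto
  then have "ferrers_realizer D ?\<F>"
    using fer pair_finite_verts by (auto simp: ferrers_realizer_def)
  then have "\<exists>k. \<exists>\<F>. ferrers_realizer D \<F> \<and> card \<F> = k"
    by blast
  then show ?thesis
    unfolding ferrers_dim_def by (rule LeastI_ex)
qed

lemma total_covering_number_J_attained:
  assumes "pair_fin_digraph D"
  shows "\<exists>\<S>. total_cover D \<S> \<and> card \<S> = total_covering_number_J D"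
proof -
  interpret pair_fin_digraph D by fact
  let ?S = "\<lambda>e. \<lparr> pverts = {e}, parcs = {} \<rparr> :: ('a \<times> 'a) pair_pre_digraph"
  have "total_subdigraph (?S e) D" if "e \<in> parcs D" for e
  proof -
    have "wf_digraph (with_proj (?S e))" "wf_digraph (with_proj (J_digraph D))"
      by (unfold_locales; auto simp: J_digraph_def)+
    then show ?thesis
      using that
      by (auto simp: total_subdigraph_def ideal_subdigraph_def subgraph_def compatible_def
          J_digraph_def)
  qed
  then have "total_cover D (?S ` parcs D)"
    using pair_finite_arcs by (auto simp: total_cover_def)
  then have "\<exists>k. \<exists>\<S>. total_cover D \<S> \<and> card \<S> = k"
    by blast
  then show ?thesis
    unfolding total_covering_number_J_def by (rule LeastI_ex)
qed

end

theory Submission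
  imports Defs
begin

text \<open>
  A digraph is Ferrers iff for all arcs \<open>ab\<close>, \<open>cd\<close> one of \<open>ad\<close>, \<open>cb\<close> is an arc. This condition is
  inherited by complements, and it says exactly that the arc set is the vertex set of some total
  subdigraph of \<open>J\<close>. Complementation therefore turns representations of \<open>D\<close> as an intersection of
  Ferrers digraphs into covers of the arcs of the complement by vertex sets of total subdigraphs,
  and back.
\<close>

text \<open>Successor sets of \<open>a\<close> and \<open>c\<close> are incomparable iff some
  \<open>b\<close> lies only in the first and some \<open>d\<close> only in the second.
  Well-formedness makes sources of arcs vertices, so \<open>a\<close> and \<open>c\<close> may range
  freely.\<close>

lemma ferrers_digraph_iff:
  "ferrers_digraph F \<longleftrightarrow> pair_wf_digraph F \<and>
     (\<forall>a b c d. (a, b) \<in> parcs F \<longrightarrow> (c, d) \<in> parcs F \<longrightarrow> (a, d) \<in> parcs F \<or> (c, b) \<in> parcs F)"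
proof (cases "pair_wf_digraph F")
  case True
  then interpret pair_wf_digraph F .
  have "a \<in> pverts F" if "(a, b) \<in> parcs F" for a b
    using in_arcsD1 that .
  then show ?thesis
    unfolding ferrers_digraph_def successors_def using True by blast
qed (simp add: ferrers_digraph_def)

lemma pverts_digraph_compl [simp]: "pverts (digraph_compl D) = pverts D"
  and parcs_digraph_compl [simp]: "parcs (digraph_compl D) = pverts D \<times> pverts D - parcs D"
  by (simp_all add: digraph_compl_def)

lemma pair_wf_digraph_compl: "pair_wf_digraph (digraph_compl D)"
  by unfold_locales auto

lemma pair_fin_digraph_compl:
  assumes "pair_fin_digraph D"
  shows "pair_fin_digraph (digraph_compl D)"
proof -
  interpret pair_fin_digraph D by fact
  show ?thesis
    by unfold_locales auto
qed

text \<open>If \<open>ab\<close>, \<open>cd\<close> are non-arcs of \<open>F\<close> while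
  \<open>ad\<close>, \<open>cb\<close> are arcs, then the criterion applied to \<open>ad\<close>,
  \<open>cb\<close> makes \<open>ab\<close> or \<open>cd\<close> an arc, a contradiction.\<close>

lemma ferrers_digraph_compl:
  assumes "ferrers_digraph F"
  shows "ferrers_digraph (digraph_compl F)"
  using assms pair_wf_digraph_compl[of F] unfolding ferrers_digraph_iff by auto

text \<open>For distinct arcs \<open>ab\<close>, \<open>cd\<close> of \<open>F\<close>, having
  \<open>ad\<close> in \<open>F\<close> yields the arc from \<open>ab\<close> to \<open>cd\<close>,
  and \<open>cb\<close> in \<open>F\<close> yields the reverse arc; the Ferrers criterion provides
  one of the two.\<close>

lemma ferrers_imp_total_subdigraph:
  assumes "ferrers_digraph F" and sub: "parcs F \<subseteq> parcs D"
  shows "\<exists>S. total_subdigraph S D \<and> pverts S = parcs F"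
proof -
  \<comment> \<open>Not the induced subdigraph: only the arcs of \<open>J\<close> that satisfy the ideal condition are kept.\<close>
  let ?S = "\<lparr> pverts = parcs F, parcs = {((a, b), (c, d)) | a b c d.
      (a, b) \<in> parcs F \<and> (c, d) \<in> parcs F \<and> (a, b) \<noteq> (c, d) \<and> (a, d) \<in> parcs F} \<rparr>"
  have "wf_digraph (with_proj ?S)" "wf_digraph (with_proj (J_digraph D))"
    by (unfold_locales; auto simp: J_digraph_def)+
  then have "ideal_subdigraph ?S D"
    using sub unfolding ideal_subdigraph_def subgraph_def compatible_def
    by (auto simp: J_digraph_def)
  then have "total_subdigraph ?S D"
    using assms(1) unfolding ferrers_digraph_iff total_subdigraph_def by (auto; blast)
  then show ?thesis
    by (intro exI[of _ ?S]) simp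
qed

lemma total_subdigraph_subset:
  assumes "total_subdigraph S D"
  shows "pverts S \<subseteq> parcs D"
  using assms
  by (auto simp: total_subdigraph_def ideal_subdigraph_def subgraph_def J_digraph_def)

lemma total_subdigraph_imp_ferrers:
  assumes "pair_wf_digraph D" and S: "total_subdigraph S D"
  shows "ferrers_digraph \<lparr> pverts = pverts D, parcs = pverts S \<rparr>"
proof -
  interpret pair_wf_digraph D by fact
  have "pverts S \<subseteq> pverts D \<times> pverts D"
    using total_subdigraph_subset[OF S] in_arcsD1 in_arcsD2 by auto
  then have "pair_wf_digraph \<lparr> pverts = pverts D, parcs = pverts S \<rparr>"
    by unfold_locales auto
  \<comment> \<open>If \<open>ab\<close> and \<open>cd\<close> coincide, then \<open>ad\<close> is
    \<open>ab\<close> itself. Otherwise totality gives an arc between them, and its direction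
    decides whether the ideal condition yields \<open>ad\<close> or \<open>cb\<close>.\<close>
  moreover have "(a, d) \<in> pverts S \<or> (c, b) \<in> pverts S"
    if "(a, b) \<in> pverts S" "(c, d) \<in> pverts S" for a b c d
    using S that unfolding total_subdigraph_def ideal_subdigraph_def by (metis prod.inject)
  ultimately show ?thesis
    by (auto simp: ferrers_digraph_iff)
qed

lemma ferrers_dim_le:
  assumes "ferrers_realizer D \<F>"
  shows "ferrers_dim D \<le> card \<F>"
  unfolding ferrers_dim_def using assms by (blast intro: Least_le)

lemma total_covering_number_J_le:
  assumes "total_cover D \<S>"
  shows "total_covering_number_J D \<le> card \<S>"
  unfolding total_covering_number_J_def using assms by (blast intro: Least_le)

lemma ferrers_realizer_imp_total_cover:
  assumes R: "ferrers_realizer D \<F>"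
  shows "\<exists>\<S>. total_cover (digraph_compl D) \<S> \<and> card \<S> \<le> card \<F>"
proof -
  have "\<exists>S. total_subdigraph S (digraph_compl D) \<and> pverts S = parcs (digraph_compl F)"
    if "F \<in> \<F>" for F
  proof (rule ferrers_imp_total_subdigraph)
    show "ferrers_digraph (digraph_compl F)"
      using R that by (simp add: ferrers_realizer_def ferrers_digraph_compl)
    show "parcs (digraph_compl F) \<subseteq> parcs (digraph_compl D)"
      using R that unfolding ferrers_realizer_def by auto
  qed
  then obtain s where s: "\<And>F. F \<in> \<F> \<Longrightarrow> total_subdigraph (s F) (digraph_compl D)"
      "\<And>F. F \<in> \<F> \<Longrightarrow> pverts (s F) = parcs (digraph_compl F)"
    by metis
  \<comment> \<open>De Morgan: a pair outside the intersection is missing from some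
    \<open>F\<close>, whose complement is taken in the same vertex square.\<close>
  have "parcs (digraph_compl D) \<subseteq> (\<Union>S \<in> s ` \<F>. pverts S)"
    using R s(2) unfolding ferrers_realizer_def by auto
  then have "total_cover (digraph_compl D) (s ` \<F>)"
    using R s(1) by (auto simp: total_cover_def ferrers_realizer_def)
  moreover have "card (s ` \<F>) \<le> card \<F>"
    using R by (simp add: ferrers_realizer_def card_image_le)
  ultimately show ?thesis
    by blast
qed

text \<open>The cardinality may drop: total subdigraphs with equal vertex sets but different arcs
  give the same Ferrers digraph.\<close>

lemma total_cover_imp_ferrers_realizer:
  assumes "pair_wf_digraph D" and C: "total_cover (digraph_compl D) \<S>"
  shows "\<exists>\<F>. ferrers_realizer D \<F> \<and> card \<F> \<le> card \<S>"
proof -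
  interpret pair_wf_digraph D by fact
  let ?f = "\<lambda>S. digraph_compl \<lparr> pverts = pverts D, parcs = pverts S \<rparr>"
  have T: "total_subdigraph S (digraph_compl D)" if "S \<in> \<S>" for S
    using C that by (simp add: total_cover_def)
  have "ferrers_digraph (?f S)" if "S \<in> \<S>" for S
    using total_subdigraph_imp_ferrers[OF pair_wf_digraph_compl T[OF that]]
    by (simp add: ferrers_digraph_compl)
  moreover have "parcs D = (pverts D \<times> pverts D) \<inter> (\<Inter>F \<in> ?f ` \<S>. parcs F)"
  proof -
    \<comment> \<open>Covering gives one inclusion. The other keeps arcs of \<open>D\<close> out of
      every vertex set, so no complement loses an arc of \<open>D\<close>.\<close>
    have "(\<Union>S \<in> \<S>. pverts S) = pverts D \<times> pverts D - parcs D"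
      using C T[THEN total_subdigraph_subset] by (auto simp: total_cover_def)
    moreover have "parcs D \<subseteq> pverts D \<times> pverts D"
      using in_arcsD1 in_arcsD2 by auto
    ultimately show ?thesis
      by auto
  qed
  ultimately have "ferrers_realizer D (?f ` \<S>)"
    using C by (auto simp: ferrers_realizer_def total_cover_def)
  moreover have "card (?f ` \<S>) \<le> card \<S>"
    using C by (simp add: total_cover_def card_image_le)
  ultimately show ?thesis
    by blast
qed

theorem theorem4:
  fixes D :: "'a pair_pre_digraph"
  assumes "pair_fin_digraph D"
  shows "ferrers_dim D = total_covering_number_J (digraph_compl D)"
proof (rule antisym)
  interpret pair_fin_digraph D by fact
  obtain \<S> where "total_cover (digraph_compl D) \<S>"
      "card \<S> = total_covering_number_J (digraph_compl D)"
    using total_covering_number_J_attained[OF pair_fin_digraph_compl[OF assms]] by blast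
  then show "ferrers_dim D \<le> total_covering_number_J (digraph_compl D)"
    using total_cover_imp_ferrers_realizer[OF pair_wf_digraph_axioms] ferrers_dim_le
    by (metis order_trans)
  obtain \<F> where "ferrers_realizer D \<F>" "card \<F> = ferrers_dim D"
    using ferrers_dim_attained[OF assms] by blast
  then show "total_covering_number_J (digraph_compl D) \<le> ferrers_dim D"
    using ferrers_realizer_imp_total_cover total_covering_number_J_le
    by (metis order_trans)
qed

end
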